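(* Let $\mathcal{G}=(\mathcal{V},\mathcal{E})$ be a connected undirected tree and let $k>0$. Consider the Stackelberg attacker-defender game on $\mathcal{G}$ with payoff $J_2(\mathfrak{F},\mathfrak{D})$, a single attacked node and a single defense node ($|\mathfrak{F}|=|\mathfrak{D}|=1$), and the defender as the game leader. Then at equilibrium the defender chooses a node in the center of the graph and the attacker chooses a node with the greatest distance from the center node chosen by the defender.
   Context: The tree is simple and unweighted, with Laplacian matrix $L=D-A$ ($A$ the adjacency matrix, $D$ the diagonal matrix of degrees). The eccentricity $\epsilon(v)$ of a vertex $v$ is the maximum graph distance between $v$ and any other vertex; the center of the graph is the set of vertices with minimum eccentricity. For a nonempty set $\mathfrak{D}\subseteq\mathcal{V}$ of defense nodes, $D_y=\mathrm{diag}(y)$ with $y_i=1$ if $i\in\mathfrak{D}$ and $y_i=0$ otherwise, and $\bar L=L+kD_y$ (invertible). For a set $\mathfrak{F}\subseteq\mathcal{V}$ of $f$ attacked nodes the payoff is $$J_2(\mathfrak{F},\mathfrak{D})=\frac12 f+\frac12\sum_{i\in\mathfrak{F}}\bar L^{-1}_{ii},$$ where $\bar L^{-1}_{ii}$ is the $i$-th diagonal element of $\bar L^{-1}$. Stackelberg game with the defender as leader: the defender first chooses $\mathfrak{D}$ and the attacker, knowing $\mathfrak{D}$, chooses a best response $\mathfrak{F}\in\arg\max_{\mathfrak{F}}J_2(\mathfrak{F},\mathfrak{D})$. An equilibrium is a pair $(\mathfrak{D}^*,\mathfrak{F}^* )$ such that $\mathfrak{D}^*$ minimizes $\max_{\mathfrak{F}}J_2(\mathfrak{F},\mathfrak{D})$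 over admissible $\mathfrak{D}$, and $\mathfrak{F}^*$ maximizes $J_2(\mathfrak{F},\mathfrak{D}^* )$ over admissible $\mathfrak{F}$ (here admissible sets are the singletons, identified with nodes). "At equilibrium" refers to every such pair. *)

theory Defs
  imports "HOL-Analysis.Analysis" "Graph_Theory.Graph_Theory"
begin

text \<open>
  A simple undirected graph is a \<^locale>\<open>pair_graph\<close>: a finite, symmetric, loop-free digraph whose
  arcs are pairs of vertices, each undirected edge being present as two opposite arcs.
  In this encoding the closed walk $u,v,u$ satisfies the library predicate
  \<^const>\<open>pre_digraph.cycle\<close>, so the library's \<^const>\<open>tree\<close> does not describe undirected trees.
  The cycles of the undirected graph are exactly the library cycles of length at least 3.
\<close>

definition undirected_tree :: "'v pair_pre_digraph \<Rightarrow> bool" where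
  "undirected_tree G \<longleftrightarrow>
     pair_graph G \<and> Digraph_Component.connected (with_proj G) \<and>
     \<not> (\<exists>p. pre_digraph.cycle (with_proj G) p \<and> 3 \<le> length p)"

definition gdist :: "'v pair_pre_digraph \<Rightarrow> 'v \<Rightarrow> 'v \<Rightarrow> ereal" where
  "gdist G u v = wf_digraph.\<mu> (with_proj G) (\<lambda>_. 1) u v"

text \<open>
  Including the vertex itself, at distance 0, only matters on the one-vertex graph, where there
  is no other vertex.
\<close>

definition eccentricity :: "'v pair_pre_digraph \<Rightarrow> 'v \<Rightarrow> ereal" where
  "eccentricity G v = Max (gdist G v ` pverts G)"

definition graph_center :: "'v pair_pre_digraph \<Rightarrow> 'v set" where
  "graph_center G = {v. is_arg_min (eccentricity G) (\<lambda>u. u \<in> pverts G) v}"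

text \<open>
  Matrices are indexed by the whole vertex type, so they are meaningful for graphs with
  \<open>pverts G = UNIV\<close>.
\<close>

definition adjacency_matrix :: "'v::finite pair_pre_digraph \<Rightarrow> real^'v^'v" where
  "adjacency_matrix G = (\<chi> i j. if (i, j) \<in> parcs G then 1 else 0)"

definition diag_matrix :: "('v::finite \<Rightarrow> real) \<Rightarrow> real^'v^'v" where
  "diag_matrix y = (\<chi> i j. if i = j then y i else 0)"

text \<open>By symmetry of the arcs, the out-degree is the undirected degree.\<close>

definition laplacian :: "'v::finite pair_pre_digraph \<Rightarrow> real^'v^'v" where
  "laplacian G = diag_matrix (\<lambda>i. real (out_degree (with_proj G) i)) - adjacency_matrix G"

definition grounded_laplacian :: "'v::finite pair_pre_digraph \<Rightarrow> real \<Rightarrow> 'v set \<Rightarrow> real^'v^'v" where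
  "grounded_laplacian G k D =
     laplacian G + k *\<^sub>R diag_matrix (\<lambda>i. if i \<in> D then 1 else 0)"

definition J2 :: "'v::finite pair_pre_digraph \<Rightarrow> real \<Rightarrow> 'v set \<Rightarrow> 'v set \<Rightarrow> real" where
  "J2 G k F D =
     1/2 * real (card F) + 1/2 * (\<Sum>i\<in>F. matrix_inv (grounded_laplacian G k D) $ i $ i)"

definition node_sets :: "'v pair_pre_digraph \<Rightarrow> nat \<Rightarrow> 'v set set" where
  "node_sets G m = {S. S \<subseteq> pverts G \<and> card S = m}"

text \<open>
  The leading defender chooses \<open>d\<close> nodes minimizing the best-response payoff of the attacker, who
  chooses \<open>f\<close> nodes.
\<close>

definition stackelberg_equilibrium ::
  "'v::finite pair_pre_digraph \<Rightarrow> real \<Rightarrow> nat \<Rightarrow> nat \<Rightarrow> 'v set \<Rightarrow> 'v set \<Rightarrow> bool" where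
  "stackelberg_equilibrium G k f d D F \<longleftrightarrow>
     is_arg_min (\<lambda>D'. Max ((\<lambda>F'. J2 G k F' D') ` node_sets G f)) (\<lambda>D'. D' \<in> node_sets G d) D \<and>
     is_arg_max (\<lambda>F'. J2 G k F' D) (\<lambda>F'. F' \<in> node_sets G f) F"

end

theory Submission
  imports Defs
begin

text \<open>
  The key point is that for a tree the diagonal of the inverse of the grounded Laplacian is explicit:
  if the defender sits at $c$, its entry at $i$ is $1/k + d(c,i)$. In electrical terms, the node
  $c$ is tied to ground through a resistor $1/k$ and every edge is a unit resistor, and in a tree the
  effective resistance between two nodes is their distance. Hence the payoff of the pair $(i, c)$
  is an increasing function of $d(c,i)$ alone, the attacker's best responses to $c$ are the nodes
  farthest from $c$, and the leading defender minimizes an increasing function of the eccentricity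
  of $c$.

  The inverse rests on one identity. Fix a root $r$. A vertex $v \neq r$ of a tree has exactly one
  neighbour closer to $r$ and all its other neighbours are one step farther away, while all
  neighbours of $r$ are at distance 1. Therefore
  $$(L\, d(\cdot, r))_v = 2 - \deg v - 2\,[v = r]$$
  (\<open>sum_hop_differences\<close>). This is the only place where acyclicity is used: two distinct
  neighbours of $v$ that are not farther from $r$ than $v$ would both be joined to $r$ by shortest
  walks that avoid $v$, and so would close a cycle through $v$.
  The term $2 - \deg v$ does not depend on the root, so it cancels in the difference for the
  two roots $c$ and $i$, and the vector
  $$x_v = \frac1k + \frac12\bigl(d(c,i) + d(v,c) - d(v,i)\bigr)$$
  satisfies $Lx = e_i - e_c$. As $x_c = 1/k$, the grounding term contributes $k x_c e_c = e_c$, and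
  $x$ is column $i$ of the inverse (\<open>grounded_laplacian_inverse\<close>).
\<close>

section \<open>Hop distance in connected graphs\<close>

locale connected_pair_graph = pair_graph +
  assumes connected_graph: "Digraph_Component.connected (with_proj G)"
begin

text \<open>
  The natural-number counterpart of \<^const>\<open>gdist\<close>, for arithmetic on distances; see
  \<open>gdist_eq_hop\<close>.
\<close>

definition hop :: "'a \<Rightarrow> 'a \<Rightarrow> nat" where
  "hop u v = (LEAST n. \<exists>p. awalk u p v \<and> length p = n)"

lemma awalk_exists:
  assumes "u \<in> pverts G" "v \<in> pverts G"
  shows "\<exists>p. awalk u p v"
proof -
  have "strongly_connected (with_proj G)"
    using symmetric_connected_imp_strongly_connected pair_sym_arcs connected_graph by blast
  then have "u \<rightarrow>\<^sup>*\<^bsub>with_proj G\<^esub> v"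
    using assms by (auto simp: strongly_connected_def)
  then show ?thesis by (simp add: reachable_awalk)
qed

lemma shortest_awalk_exists:
  assumes "u \<in> pverts G" "v \<in> pverts G"
  shows "\<exists>p. awalk u p v \<and> length p = hop u v"
proof -
  have "\<exists>n p. awalk u p v \<and> length p = n" using awalk_exists[OF assms] by blast
  then show ?thesis unfolding hop_def by (rule LeastI_ex)
qed

lemma hop_le_length: "awalk u p v \<Longrightarrow> hop u v \<le> length p"
  unfolding hop_def by (rule Least_le) blast

lemma hop_sym_le:
  assumes "u \<in> pverts G" "v \<in> pverts G"
  shows "hop v u \<le> hop u v"
proof -
  obtain p where p: "awalk u p v" "length p = hop u v"
    using shortest_awalk_exists[OF assms] by blast
  have "length (rev_path q) = length q" for q :: "('a \<times> 'a) awalk" by (induct q) auto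
  moreover have "awalk v (rev_path p) u" using p(1) by simp
  ultimately show ?thesis using hop_le_length[of v "rev_path p" u] p(2) by simp
qed

lemma hop_sym:
  assumes "u \<in> pverts G" "v \<in> pverts G"
  shows "hop u v = hop v u"
  using hop_sym_le[OF assms] hop_sym_le[OF assms(2,1)] by simp

lemma hop_self: "u \<in> pverts G \<Longrightarrow> hop u u = 0"
  using hop_le_length[of u "[]" u] by (simp add: awalk_Nil_iff)

lemma hop_arc_le:
  assumes "(v, w) \<in> parcs G" "c \<in> pverts G"
  shows "hop v c \<le> Suc (hop w c)"
proof -
  obtain p where p: "awalk w p c" "length p = hop w c"
    using shortest_awalk_exists[OF in_arcsD2[OF assms(1)] assms(2)] by blast
  have "awalk v ((v, w) # p) c" using p(1) assms(1) by (simp add: awalk_Cons_iff)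
  from hop_le_length[OF this] show ?thesis using p(2) by simp
qed

lemma closer_neighbour_exists:
  assumes "v \<in> pverts G" "c \<in> pverts G" "v \<noteq> c"
  shows "\<exists>w. (v, w) \<in> parcs G \<and> hop v c = Suc (hop w c)"
proof -
  obtain p where p: "awalk v p c" "length p = hop v c"
    using shortest_awalk_exists assms by blast
  obtain e q where eq: "p = e # q"
    using p(1) assms(3) by (cases p) (auto simp: awalk_Nil_iff)
  obtain w where e: "e = (v, w)" "(v, w) \<in> parcs G" "awalk w q c"
    using p(1) unfolding eq by (cases e) (auto simp: awalk_Cons_iff)
  have "Suc (hop w c) \<le> hop v c" using hop_le_length[OF e(3)] p(2) eq by simp
  moreover have "hop v c \<le> Suc (hop w c)" using hop_arc_le e(2) assms(2) by blast
  ultimately have "hop v c = Suc (hop w c)" by simp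
  then show ?thesis using e(2) by blast
qed

text \<open>
  The part of the walk from $x$ on already reaches the target, and it is strictly shorter unless
  the cut is made at the very start. This is what keeps shortest walks away from a vertex at least as
  far from the target as $u$.
\<close>

lemma shortest_awalk_interior_closer:
  assumes "awalk u p c" "length p = hop u c" "x \<in> set (awalk_verts u p)"
  shows "x = u \<or> hop x c < hop u c"
proof -
  obtain q r where qr: "p = q @ r" "awalk u q x" "awalk x r c"
    using awalk_decomp[OF assms(1,3)] by (elim exE conjE)
  show ?thesis
  proof (cases "q = []")
    case True
    then show ?thesis using qr(2) by (simp add: awalk_Nil_iff)
  next
    case False
    then have "length r < length p" using qr(1) by simp
    then show ?thesis using hop_le_length[OF qr(3)] assms(2) by simp
  qed
qed

lemma gdist_eq_hop:
  assumes "u \<in> pverts G" "v \<in> pverts G"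
  shows "gdist G u v = ereal (real (hop u v))"
proof -
  have cost: "awalk_cost (\<lambda>_. 1) p = real (length p)" for p :: "('a \<times> 'a) awalk"
    by (induct p) auto
  obtain p where p: "awalk u p v" "length p = hop u v"
    using shortest_awalk_exists[OF assms] by blast
  have "(INF q\<in>{q. awalk u q v}. ereal (awalk_cost (\<lambda>_. 1) q)) = ereal (real (hop u v))"
    unfolding cost
  proof (rule INF_eqI)
    fix y assume "\<And>q. q \<in> {q. awalk u q v} \<Longrightarrow> y \<le> ereal (real (length q))"
    then show "y \<le> ereal (real (hop u v))" using p by force
  qed (auto simp: hop_le_length)
  then show ?thesis unfolding gdist_def \<mu>_def .
qed

end

section \<open>Distances in trees\<close>

locale tree_pair_graph = connected_pair_graph +
  assumes no_long_cycle: "\<not> (\<exists>p. cycle p \<and> 3 \<le> length p)"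
begin

text \<open>
  A path from $w_1$ to $w_2$ that misses their common neighbour $v$ closes up through $v$ to a
  cycle. Its length is at least 3 precisely because $w_1 \neq w_2$ makes the path nonempty, so it
  is not one of the back-and-forth walks along a single edge.
\<close>

lemma no_detour_between_neighbours:
  assumes "(v, w1) \<in> parcs G" "(v, w2) \<in> parcs G"
    and "awalk w1 q w2" "v \<notin> set (awalk_verts w1 q)"
  shows "w1 = w2"
proof (rule ccontr)
  assume "w1 \<noteq> w2"
  define p where "p = awalk_to_apath q"
  have p: "apath w1 p w2" and "set p \<subseteq> set q"
    using apath_awalk_to_apath[OF assms(3)] awalk_to_apath_subset[OF assms(3)]
    by (auto simp: p_def)
  have wp: "awalk w1 p w2" using p by (simp add: apath_def)
  have sub: "set (awalk_verts w1 p) \<subseteq> set (awalk_verts w1 q)"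
    using set_awalk_verts[OF wp] set_awalk_verts[OF assms(3)] \<open>set p \<subseteq> set q\<close> by auto
  have ne: "p \<noteq> []" using wp \<open>w1 \<noteq> w2\<close> by (auto simp: awalk_Nil_iff)
  let ?c = "(v, w1) # p @ [(w2, v)]"
  have arc: "(w2, v) \<in> parcs G" using assms(2) arcs_symmetric by blast
  have closing: "awalk w1 (p @ [(w2, v)]) v"
    using wp arc by (intro awalk_appendI) (auto simp: awalk_simps in_arcsD2)
  have wc: "awalk v ?c v"
    unfolding awalk_Cons_iff[of v "(v, w1)"] using closing assms(1) by (simp del: awalk_append_iff)
  have "tl (awalk_verts v ?c) = awalk_verts w1 p @ [v]"
    using awalk_verts_append[OF closing] wp by simp
  moreover have "distinct (awalk_verts w1 p @ [v])"
    using p sub assms(4) by (auto simp: apath_def)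
  ultimately have "cycle ?c" using wc unfolding cycle_def by (intro exI[of _ v]) simp
  moreover have "3 \<le> length ?c" using ne by (cases p) auto
  ultimately show False using no_long_cycle by blast
qed

text \<open>
  Shortest walks to $c$ from both neighbours avoid $v$, since all their later vertices are strictly
  closer to $c$ than $v$; joined at $c$ they form a forbidden detour. Allowing equality of distances
  in the hypotheses excludes at once a second closer neighbour and a neighbour at the same distance
  as $v$.
\<close>

lemma neighbour_not_farther_unique:
  assumes "c \<in> pverts G" "(v, w1) \<in> parcs G" "(v, w2) \<in> parcs G"
    and "hop w1 c \<le> hop v c" "hop w2 c \<le> hop v c"
  shows "w1 = w2"
proof -
  have avoid: "\<exists>p. awalk w p c \<and> v \<notin> set (awalk_verts w p)"
    if arc: "(v, w) \<in> parcs G" and le: "hop w c \<le> hop v c" for w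
  proof -
    obtain p where p: "awalk w p c" "length p = hop w c"
      using shortest_awalk_exists[OF in_arcsD2[OF arc] assms(1)] by blast
    have "v \<noteq> w" using arc no_loops' by blast
    then have "v \<notin> set (awalk_verts w p)"
      using shortest_awalk_interior_closer[OF p, of v] le by auto
    then show ?thesis using p(1) by blast
  qed
  obtain p1 where p1: "awalk w1 p1 c" "v \<notin> set (awalk_verts w1 p1)"
    using avoid[of w1] assms by blast
  obtain p2 where p2: "awalk w2 p2 c" "v \<notin> set (awalk_verts w2 p2)"
    using avoid[of w2] assms by blast
  have r: "awalk c (rev_path p2) w2" using p2(1) by simp
  have "awalk w1 (p1 @ rev_path p2) w2" using p1(1) r by (rule awalk_appendI)
  moreover have "v \<notin> set (awalk_verts w1 (p1 @ rev_path p2))"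
    using set_awalk_verts_append[OF p1(1) r] awalk_verts_rev_path[OF p2(1)] p1(2) p2(2) by simp
  ultimately show ?thesis using no_detour_between_neighbours assms(2,3) by blast
qed

text \<open>
  The Laplacian of the distance to $c$: the neighbour towards $c$ contributes $1$ and every other
  neighbour $-1$; at $v = c$ there is no neighbour of the first kind. The dependence on the root $c$
  is confined to the point $v = c$.
\<close>

lemma sum_hop_differences:
  assumes "v \<in> pverts G" "c \<in> pverts G"
  shows "(\<Sum>w | (v, w) \<in> parcs G. real (hop v c) - real (hop w c))
       = (if v = c then 0 else 2) - real (card {w. (v, w) \<in> parcs G})"
proof -
  let ?N = "{w. (v, w) \<in> parcs G}"
  have fin: "finite ?N"
    by (rule finite_subset[OF _ pair_finite_verts]) (auto dest: in_arcsD2)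
  have farther: "real (hop v c) - real (hop w c) = -1" if "w \<in> ?N" "hop v c < hop w c" for w
  proof -
    have "(w, v) \<in> parcs G" using that(1) arcs_symmetric by blast
    then have "hop w c = Suc (hop v c)" using hop_arc_le[of w v c] assms(2) that(2) by simp
    then show ?thesis by simp
  qed
  show ?thesis
  proof (cases "v = c")
    case True
    have "real (hop v c) - real (hop w c) = -1" if "w \<in> ?N" for w
    proof -
      have arc: "(v, w) \<in> parcs G" using that by simp
      then have "w \<noteq> v" using no_loops' by blast
      then obtain x where "hop w c = Suc (hop x c)"
        using closer_neighbour_exists[OF in_arcsD2[OF arc] assms(2)] True by blast
      then show ?thesis using farther[OF that] hop_self[OF assms(2)] True by simp
    qed
    then have "(\<Sum>w\<in>?N. real (hop v c) - real (hop w c)) = (\<Sum>w\<in>?N. - 1)"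
      by (rule sum.cong[OF refl])
    then show ?thesis using True by simp
  next
    case False
    obtain u where u: "u \<in> ?N" "hop v c = Suc (hop u c)"
      using closer_neighbour_exists[OF assms False] by blast
    have rest: "real (hop v c) - real (hop w c) = -1" if "w \<in> ?N - {u}" for w
    proof (rule farther)
      show "w \<in> ?N" using that by blast
      show "hop v c < hop w c"
      proof (rule ccontr)
        assume "\<not> hop v c < hop w c"
        then have "w = u"
          using neighbour_not_farther_unique[OF assms(2), of v w u] u that by simp
        then show False using that by blast
      qed
    qed
    have "(\<Sum>w\<in>?N. real (hop v c) - real (hop w c))
        = 1 + (\<Sum>w\<in>?N - {u}. real (hop v c) - real (hop w c))"
      by (subst sum.remove[OF fin u(1)]) (simp add: u(2))
    also have "(\<Sum>w\<in>?N - {u}. real (hop v c) - real (hop w c)) = (\<Sum>w\<in>?N - {u}. - 1)"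
      using rest by (rule sum.cong[OF refl])
    also have "1 + \<dots> = 2 - real (card ?N)"
      using card_Suc_Diff1[OF fin u(1)] by simp
    finally show ?thesis using False by simp
  qed
qed

end

lemma undirected_tree_imp_tree_pair_graph:
  "undirected_tree G \<Longrightarrow> tree_pair_graph G"
  unfolding undirected_tree_def tree_pair_graph_def tree_pair_graph_axioms_def
    connected_pair_graph_def connected_pair_graph_axioms_def by blast

section \<open>The inverse of the grounded Laplacian\<close>

lemma matrix_inv_eqI:
  fixes A B :: "real^'n^'n"
  assumes "A ** B = mat 1"
  shows "matrix_inv A = B"
proof -
  have BA: "B ** A = mat 1" using assms matrix_left_right_inverse by blast
  have inv: "A ** matrix_inv A = mat 1 \<and> matrix_inv A ** A = mat 1"
    unfolding matrix_inv_def by (rule someI[of _ B]) (use assms BA in simp)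
  have "matrix_inv A = matrix_inv A ** (A ** B)" using assms by simp
  also have "\<dots> = (matrix_inv A ** A) ** B" by (rule matrix_mul_assoc)
  also have "\<dots> = B" using inv by simp
  finally show ?thesis .
qed

lemma diag_matrix_vector_mult: "(diag_matrix y *v x) $ v = y v * x $ v"
proof -
  have "(diag_matrix y *v x) $ v = (\<Sum>j\<in>UNIV. (if v = j then y v else 0) * x $ j)"
    by (simp add: diag_matrix_def matrix_vector_mult_def)
  also have "\<dots> = (\<Sum>j\<in>UNIV. if v = j then y v * x $ j else 0)"
    by (rule sum.cong) auto
  finally show ?thesis by simp
qed

lemma laplacian_vector_mult:
  "(laplacian G *v x) $ v = (\<Sum>w | (v, w) \<in> parcs G. x $ v - x $ w)"
proof -
  have "out_arcs (with_proj G) v = Pair v ` {w. (v, w) \<in> parcs G}"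
    by (auto simp: out_arcs_def)
  then have deg: "out_degree (with_proj G) v = card {w. (v, w) \<in> parcs G}"
    by (simp add: out_degree_def card_image inj_on_def)
  have "(adjacency_matrix G *v x) $ v = (\<Sum>j\<in>UNIV. if (v, j) \<in> parcs G then x $ j else 0)"
    unfolding adjacency_matrix_def matrix_vector_mult_def by (auto intro!: sum.cong)
  also have "\<dots> = (\<Sum>w | (v, w) \<in> parcs G. x $ w)"
    by (simp add: sum.If_cases)
  finally show ?thesis
    unfolding laplacian_def
    by (simp add: matrix_vector_mult_diff_rdistrib diag_matrix_vector_mult deg sum_subtractf)
qed

text \<open>The matrices are indexed by the whole vertex type, so every element of it must be a vertex.\<close>

locale tree_on_type = tree_pair_graph G
  for G :: "'v::finite pair_pre_digraph" +
  assumes all_vertices: "pverts G = UNIV"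
begin

text \<open>
  In column $i$, the Laplacian turns the half difference of the distances to $c$ and to $i$ into
  $e_i - e_c$, and the constant $1/k + d(c,i)/2$ is chosen so that the entry at $c$ is $1/k$, which
  makes the grounding term cancel $-e_c$. The entry at $v$ is $1/k$ plus the number of edges that the
  paths from $c$ to $v$ and from $c$ to $i$ share.
\<close>

lemma grounded_laplacian_inverse:
  assumes "k \<noteq> 0"
  shows "matrix_inv (grounded_laplacian G k {c})
       = (\<chi> v i. 1 / k + (real (hop c i) + real (hop v c) - real (hop v i)) / 2)"
    (is "_ = ?B")
proof (rule matrix_inv_eqI)
  have verts: "u \<in> pverts G" for u using all_vertices by simp
  show "grounded_laplacian G k {c} ** ?B = mat 1"
    unfolding vec_eq_iff
  proof (intro allI)
    fix v i
    define x :: "real^'v"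
      where "x = (\<chi> v. 1 / k + (real (hop c i) + real (hop v c) - real (hop v i)) / 2)"
    have "(grounded_laplacian G k {c} ** ?B) $ v $ i = (grounded_laplacian G k {c} *v x) $ v"
      by (simp add: matrix_matrix_mult_def matrix_vector_mult_def x_def)
    also have "\<dots> = (laplacian G *v x) $ v + (if v = c then k * x $ v else 0)"
      unfolding grounded_laplacian_def
      by (simp add: matrix_vector_mult_add_rdistrib scaleR_matrix_vector_assoc[symmetric]
          diag_matrix_vector_mult)
    also have "(laplacian G *v x) $ v =
        (\<Sum>w | (v, w) \<in> parcs G. (real (hop v c) - real (hop w c)) / 2
           - (real (hop v i) - real (hop w i)) / 2)"
      unfolding laplacian_vector_mult by (rule sum.cong) (auto simp: x_def field_simps)
    also have "\<dots> = (\<Sum>w | (v, w) \<in> parcs G. real (hop v c) - real (hop w c)) / 2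
        - (\<Sum>w | (v, w) \<in> parcs G. real (hop v i) - real (hop w i)) / 2"
      by (subst sum_subtractf) (simp only: sum_divide_distrib)
    also have "\<dots> = (if v = i then 1 else 0) - (if v = c then 1 else 0)"
      unfolding sum_hop_differences[OF verts verts] by (simp add: field_simps)
    also have "(if v = c then k * x $ v else 0) = (if v = c then 1 else 0)"
      using assms hop_self[OF verts, of c] by (simp add: x_def)
    finally show "(grounded_laplacian G k {c} ** ?B) $ v $ i = (mat 1 :: real^'v^'v) $ v $ i"
      by (simp add: mat_def)
  qed
qed

lemma J2_singletons:
  assumes "k \<noteq> 0"
  shows "J2 G k {i} {c} = 1/2 + (1 / k + real (hop c i)) / 2"
  using hop_self[of i] hop_sym[of i c] assms all_vertices
  by (simp add: J2_def grounded_laplacian_inverse)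

end

section \<open>The equilibrium\<close>

lemma node_sets_1: "pverts G = UNIV \<Longrightarrow> node_sets G 1 = range (\<lambda>v. {v})"
  by (auto simp: node_sets_def card_1_singleton_iff)

theorem corollary1:
  fixes G :: "'v::finite pair_pre_digraph" and k :: real and D F :: "'v set"
  assumes "undirected_tree G"
    and "pverts G = UNIV"
    and "k > 0"
    and "stackelberg_equilibrium G k 1 1 D F"
  shows "\<exists>c a. D = {c} \<and> F = {a} \<and> c \<in> graph_center G \<and>
           is_arg_max (gdist G c) (\<lambda>v. v \<in> pverts G) a"
proof -
  interpret tree_on_type G
    using undirected_tree_imp_tree_pair_graph[OF assms(1)] assms(2)
    by (simp add: tree_on_type_def tree_on_type_axioms_def)
  define payoff :: "real \<Rightarrow> real" where "payoff t = 1/2 + (1 / k + t) / 2" for t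
  define ecc where "ecc c = Max (range (hop c))" for c
  have J2: "J2 G k {i} {c} = payoff (real (hop c i))" for i c
    using J2_singletons assms(3) by (simp add: payoff_def)
  have gdist: "gdist G u v = ereal (real (hop u v))" for u v
    using gdist_eq_hop assms(2) by simp
  \<comment> \<open>Both the payoff and the embedding into the extended reals are monotone in the distance, so they
    commute with the maximum over all nodes.\<close>
  have best_response_payoff: "Max ((\<lambda>F'. J2 G k F' {c}) ` node_sets G 1) = payoff (real (ecc c))" for c
  proof -
    have "mono (\<lambda>n. payoff (real n))" by (auto simp: mono_def payoff_def divide_right_mono)
    from mono_Max_commute[OF this, of "range (hop c)"] show ?thesis
      unfolding node_sets_1[OF assms(2)] by (simp add: ecc_def image_image J2)
  qed
  have eccentricity: "eccentricity G c = ereal (real (ecc c))" for c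
  proof -
    have "mono (\<lambda>n. ereal (real n))" by (auto simp: mono_def)
    from mono_Max_commute[OF this, of "range (hop c)"] show ?thesis
      unfolding eccentricity_def by (simp add: ecc_def image_image gdist assms(2))
  qed
  from assms(4) have leader: "is_arg_min (\<lambda>D'. Max ((\<lambda>F'. J2 G k F' D') ` node_sets G 1))
        (\<lambda>D'. D' \<in> node_sets G 1) D"
    and follower: "is_arg_max (\<lambda>F'. J2 G k F' D) (\<lambda>F'. F' \<in> node_sets G 1) F"
    unfolding stackelberg_equilibrium_def by auto
  have "D \<in> node_sets G 1" "F \<in> node_sets G 1"
    using leader follower by (simp_all only: is_arg_min_def is_arg_max_def)
  then obtain c a where c: "D = {c}" and a: "F = {a}"
    unfolding node_sets_1[OF assms(2)] by auto
  have singleton: "{u} \<in> node_sets G 1" for u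
    unfolding node_sets_1[OF assms(2)] by simp
  have payoff_less: "payoff s < payoff t \<longleftrightarrow> s < t" for s t
    by (simp add: payoff_def)
  have "\<not> payoff (real (ecc u)) < payoff (real (ecc c))" for u
    using leader singleton[of u] unfolding is_arg_min_def c
    by (simp only: best_response_payoff[symmetric]) blast
  then have "c \<in> graph_center G"
    by (simp add: graph_center_def is_arg_min_def eccentricity payoff_less assms(2))
  moreover have "\<not> payoff (real (hop c a)) < payoff (real (hop c u))" for u
    using follower singleton[of u] unfolding is_arg_max_def c a
    by (simp only: J2[symmetric]) blast
  then have "is_arg_max (gdist G c) (\<lambda>v. v \<in> pverts G) a"
    by (simp add: is_arg_max_def gdist payoff_less assms(2))
  ultimately show ?thesis using c a by blast
qed

end
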